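(* Let $n_1,\ldots,n_k\ge1$ be integers with $n_1+\cdots+n_k=n$, and let $\gamma\in B_n$ be a permutation with exactly $k$ orbits, all of them inversion-invariant, of sizes $2n_1,\ldots,2n_k$. Let $\tau$ be a permutation in $\mathcal{S}^{(B)}_{nc}(n_1,\ldots,n_k)=\{\tau\in B_n\mid\tau\le\gamma\}$. Denote $\#(\tau,\gamma)=:m$ (so $1\le m\le k$), and let $Y_1,\ldots,Y_m$ denote the orbits of the subgroup of $B_n$ generated by $\{\tau,\gamma\}$, with $|Y_j|=2y_j$, $j=1,\ldots,m$. For every $1\le j\le m$, denote the restrictions of $\tau$ and $\gamma$ to $Y_j$ by $\tau_j$ and $\gamma_j$, respectively. Then $$\#(\gamma_j)=ii(\gamma_j)\le2,\qquad j=1,\ldots,m.$$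
   Context: The hyperoctahedral group $B_n$ is the group of permutations $\tau$ of $\{\pm 1,\ldots,\pm n\}$ with $\tau(-i) = -\tau(i)$ for $1\le i\le n$. It is generated by the set consisting of the elements $(i,j)(-i,-j)$ and $(i,-j)(-i,j)$ for $1\le i,j\le n$, $i\neq j$, and the elements $(i,-i)$ for $1\le i\le n$. For $\tau\in B_n$, let $\ell_B(\tau)$ be the smallest $k\ge 0$ such that $\tau$ is a product of $k$ of these generators (the empty product being the identity). The partial order on $B_n$ is: $\tau\le\sigma$ if and only if $\ell_B(\sigma)=\ell_B(\tau)+\ell_B(\tau^{-1}\sigma)$. An orbit $A\subseteq\{\pm1,\ldots,\pm n\}$ is inversion-invariant if $A=-A$. For $\tau\in B_n$, $\#(\tau)$ denotes the number of orbits of $\tau$ and $ii(\tau)$ the number of inversion-invariant orbits of $\tau$; the same notations are used for the restriction of an element of $B_n$ to an invariant subset of $\{\pm1,\ldots,\pm n\}$. For $\tau,\sigma\in B_n$, $\#(\tau,\sigma)$ denotes the number of orbits of the action on $\{\pm1,\ldots,\pm n\}$ of the subgroup of $B_n$ generated by $\{\tau,\sigma\}$. *)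

theory Defs
  imports
    "HOL-Combinatorics.Combinatorics"
    "HOL-Algebra.Elementary_Groups"
    "HOL-Algebra.Group_Action"
    "HOL-Algebra.Sym_Groups"
begin

definition signed_points :: "nat \<Rightarrow> int set" where
  "signed_points n = {- int n..int n} - {0}"

text \<open>
  As with \<^const>\<open>sym_group\<close>, elements are functions on the whole type fixing every point outside
  the set being permuted, and the product is function composition.
\<close>

definition hyperoctahedral_group :: "nat \<Rightarrow> (int \<Rightarrow> int) monoid" where
  "hyperoctahedral_group n =
     \<lparr>carrier = {\<tau>. \<tau> permutes signed_points n \<and> (\<forall>i\<in>{1..int n}. \<tau> (- i) = - \<tau> i)},
      mult = (\<circ>), one = id\<rparr>"

definition type_B_generators :: "nat \<Rightarrow> (int \<Rightarrow> int) set" where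
  "type_B_generators n =
     {transpose i j \<circ> transpose (- i) (- j) | i j. i \<in> {1..int n} \<and> j \<in> {1..int n} \<and> i \<noteq> j}
   \<union> {transpose i (- j) \<circ> transpose (- i) j | i j. i \<in> {1..int n} \<and> j \<in> {1..int n} \<and> i \<noteq> j}
   \<union> {transpose i (- i) | i. i \<in> {1..int n}}"

definition type_B_length :: "nat \<Rightarrow> (int \<Rightarrow> int) \<Rightarrow> nat" where
  "type_B_length n \<tau> =
     (LEAST k. \<exists>ts. length ts = k \<and> set ts \<subseteq> type_B_generators n \<and>
                    \<tau> = foldr (mult (hyperoctahedral_group n)) ts (one (hyperoctahedral_group n)))"

text \<open>Only meaningful for elements of the hyperoctahedral group.\<close>

definition type_B_le :: "nat \<Rightarrow> (int \<Rightarrow> int) \<Rightarrow> (int \<Rightarrow> int) \<Rightarrow> bool" where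
  "type_B_le n \<tau> \<sigma> \<longleftrightarrow>
     type_B_length n \<sigma> =
       type_B_length n \<tau> +
       type_B_length n (inv\<^bsub>hyperoctahedral_group n\<^esub> \<tau> \<otimes>\<^bsub>hyperoctahedral_group n\<^esub> \<sigma>)"

definition type_B_nc :: "nat \<Rightarrow> (int \<Rightarrow> int) \<Rightarrow> (int \<Rightarrow> int) set" where
  "type_B_nc n \<gamma> = {\<tau> \<in> carrier (hyperoctahedral_group n). type_B_le n \<tau> \<gamma>}"

text \<open>
  Orbits of a permutation on an invariant set \<open>X\<close>. The set is an argument because a restriction
  to \<open>X\<close> is again a function on the whole type, and its fixed points outside \<open>X\<close> are not to be
  counted as orbits.
\<close>

definition perm_orbits :: "(int \<Rightarrow> int) \<Rightarrow> int set \<Rightarrow> int set set" where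
  "perm_orbits f X = Orbits.orbit f ` X"

text \<open>Not \<open>A = - A\<close>: on sets, unary minus is the complement.\<close>

definition inversion_invariant :: "int set \<Rightarrow> bool" where
  "inversion_invariant A \<longleftrightarrow> uminus ` A = A"

definition num_orbits :: "(int \<Rightarrow> int) \<Rightarrow> int set \<Rightarrow> nat" where
  "num_orbits f X = card (perm_orbits f X)"

definition num_ii_orbits :: "(int \<Rightarrow> int) \<Rightarrow> int set \<Rightarrow> nat" where
  "num_ii_orbits f X = card {A \<in> perm_orbits f X. inversion_invariant A}"

text \<open>
  The restriction of the elements makes the action a \<^locale>\<open>group_action\<close> in the library sense,
  where permutations of a set are undefined outside of it.
\<close>

definition joint_orbits :: "nat \<Rightarrow> (int \<Rightarrow> int) \<Rightarrow> (int \<Rightarrow> int) \<Rightarrow> int set set" where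
  "joint_orbits n \<tau> \<sigma> =
     Group_Action.orbits (subgroup_generated (hyperoctahedral_group n) {\<tau>, \<sigma>})
       (signed_points n) (\<lambda>g. restrict g (signed_points n))"

lemma hyperoctahedral_odd:
  assumes "\<tau> \<in> carrier (hyperoctahedral_group n)"
  shows "\<tau> (- x) = - \<tau> x"
proof (cases "x \<in> signed_points n")
  case True
  then have "x \<in> {1..int n} \<or> - x \<in> {1..int n}"
    by (auto simp: signed_points_def)
  moreover have "\<forall>i\<in>{1..int n}. \<tau> (- i) = - \<tau> i"
    using assms by (simp add: hyperoctahedral_group_def)
  ultimately show ?thesis by (metis minus_minus)
next
  case False
  then have "- x \<notin> signed_points n" by (auto simp: signed_points_def)
  with False assms show ?thesis
    by (auto simp: hyperoctahedral_group_def permutes_not_in[of \<tau>])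
qed

lemma group_hyperoctahedral: "group (hyperoctahedral_group n)"
proof (rule groupI)
  fix x y assume "x \<in> carrier (hyperoctahedral_group n)" "y \<in> carrier (hyperoctahedral_group n)"
  moreover from this have "x (- i) = - x i" for i
    by (simp add: hyperoctahedral_odd)
  ultimately show "x \<otimes>\<^bsub>hyperoctahedral_group n\<^esub> y \<in> carrier (hyperoctahedral_group n)"
    by (auto simp: hyperoctahedral_group_def intro: permutes_compose)
next
  fix x assume x: "x \<in> carrier (hyperoctahedral_group n)"
  then have p: "x permutes signed_points n" by (simp add: hyperoctahedral_group_def)
  have "inv' x (- i) = - inv' x i" for i
    using hyperoctahedral_odd[OF x, of "inv' x i"] permutes_inverses[OF p] by metis
  then have "inv' x \<in> carrier (hyperoctahedral_group n)"
    using permutes_inv[OF p] by (simp add: hyperoctahedral_group_def)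
  moreover have "inv' x \<otimes>\<^bsub>hyperoctahedral_group n\<^esub> x = \<one>\<^bsub>hyperoctahedral_group n\<^esub>"
    using permutes_inv_o(2)[OF p] by (simp add: hyperoctahedral_group_def)
  ultimately show "\<exists>y\<in>carrier (hyperoctahedral_group n).
      y \<otimes>\<^bsub>hyperoctahedral_group n\<^esub> x = \<one>\<^bsub>hyperoctahedral_group n\<^esub>" by blast
qed (auto simp: hyperoctahedral_group_def permutes_id comp_assoc)

end

theory Submission
  imports
    Defs
    "HOL-Library.Numeral_Type"
    "HOL-Library.Function_Algebras"
    "HOL-Library.Product_Plus"
begin

text \<open>
  Write \<open>a = \<tau>\<close> and \<open>b = \<tau>\<inverse> \<gamma>\<close>, so \<open>a \<circ> b = \<gamma>\<close>. The proof plays two inequalities between the numbers of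
  orbits of \<open>a\<close>, \<open>b\<close> and \<open>\<gamma>\<close> against each other. Numbers of orbits are read off from sets of
  functions with values in \<open>\<int>/3\<close>: a function is invariant under a permutation iff it is constant on
  its orbits, so \<open>c\<close> orbits give \<open>3 ^ c\<close> invariant functions. Thus cardinalities replace dimensions,
  and 2 being invertible modulo 3 every function is the sum of an even and an odd one.

  An odd invariant function vanishes on inversion-invariant orbits, so there are \<open>3 ^ c\<close> of them,
  where \<open>c\<close> is the number of pairs of opposite orbits that are not inversion-invariant. Being
  invariant under a generator is a single linear condition on odd functions; hence a product of \<open>l\<close>
  generators fixes at least \<open>3 ^ (n - l)\<close> of the \<open>3 ^ n\<close> odd functions
  (\<open>card_odd_le_power3_length\<close>). As \<open>\<ell>\<^sub>B(a) + \<ell>\<^sub>B(b) = \<ell>\<^sub>B(\<gamma>) \<le> n\<close>, there are at least \<open>3 ^ n\<close> pairs of an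
  \<open>a\<close>-invariant and a \<open>b\<close>-invariant odd function. On the other hand, a function invariant under both
  is invariant under \<open>\<gamma>\<close>, and an odd \<open>\<gamma>\<close>-invariant function is zero because all orbits of \<open>\<gamma>\<close> are
  inversion-invariant. So different pairs have different sums, and counting shows that every odd
  function is such a sum (\<open>odd_funs_decompose\<close>). This property passes to each joint orbit \<open>Y\<close> by
  cutting functions off outside \<open>Y\<close> (\<open>card_odd_le_on_invariant_subset\<close>). In terms of orbits it
  says \<open>#(a) - ii(a) + #(b) - ii(b) \<ge> \<bar>Y\<bar>\<close> on \<open>Y\<close>.

  The joint action on \<open>Y\<close> is transitive, so the genus inequality
  \<open>#(a) + #(b) + #(a \<circ> b) \<le> \<bar>Y\<bar> + 2\<close> holds there (\<open>genus_inequality\<close>). The two inequalities together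
  leave \<open>#(\<gamma>) \<le> 2\<close> on \<open>Y\<close> (\<open>num_orbits_le_2\<close>).
\<close>

section \<open>Counting with additive maps\<close>

lemma mod3_cases: "(c::3) = 0 \<or> c = 1 \<or> c = -1"
proof -
  have "card {0, 1, -1 :: 3} = CARD(3)" by simp
  then have "{0, 1, -1 :: 3} = UNIV" by (intro card_eq_UNIV_imp_eq_UNIV) auto
  then show ?thesis by blast
qed

lemma mod3_eq_uminus_self: "(c::3) = - c \<Longrightarrow> c = 0"
  using mod3_cases[of c] by auto

lemma mod3_double: "(c::3) + c = - c"
  using mod3_cases[of c] by auto

lemma mod3_double_eq: "(c::3) + c = d + d \<Longrightarrow> c = d"
  by (simp add: mod3_double)

text \<open>
  The counting form of the rank-nullity theorem: all nonempty fibres of an additive map are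
  translates of its kernel.
\<close>
lemma card_eq_card_kernel_times_card_image:
  fixes h :: "'a::ab_group_add \<Rightarrow> 'b::ab_group_add"
  assumes fin: "finite S" and S: "\<And>x y. x \<in> S \<Longrightarrow> y \<in> S \<Longrightarrow> x - y \<in> S"
    and h: "\<And>x y. x \<in> S \<Longrightarrow> y \<in> S \<Longrightarrow> h (x - y) = h x - h y"
  shows "card S = card {x \<in> S. h x = 0} * card (h ` S)"
proof -
  have add: "x + y \<in> S" "h (x + y) = h x + h y" if "x \<in> S" "y \<in> S" for x y
  proof -
    have "0 \<in> S" using S[OF that(1,1)] by simp
    moreover from this have "h 0 = 0" using h[of 0 0] by simp
    ultimately have "- y \<in> S" "h (- y) = - h y" using that(2) S[of 0 y] h[of 0 y] by simp_all
    then show "x + y \<in> S" "h (x + y) = h x + h y"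
      using S[OF that(1), of "- y"] h[OF that(1), of "- y"] by simp_all
  qed
  have fibre: "card {x \<in> S. h x = h y} = card {x \<in> S. h x = 0}" if y: "y \<in> S" for y
  proof -
    have "bij_betw (\<lambda>x. x + y) {x \<in> S. h x = 0} {x \<in> S. h x = h y}"
      by (rule bij_betw_byWitness[where f' = "\<lambda>x. x - y"]) (use y S h add in auto)
    then show ?thesis by (simp add: bij_betw_same_card)
  qed
  have "card S = card (\<Union>z\<in>h ` S. {x \<in> S. h x = z})"
    by (rule arg_cong[where f = card]) auto
  also have "\<dots> = (\<Sum>z\<in>h ` S. card {x \<in> S. h x = z})"
    using fin by (intro card_UN_disjoint) auto
  also have "\<dots> = (\<Sum>z\<in>h ` S. card {x \<in> S. h x = 0})"
    by (rule sum.cong) (auto simp: fibre)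
  finally show ?thesis by (simp add: mult.commute)
qed

lemma card_le_3_times_card_kernel:
  fixes h :: "'a::ab_group_add \<Rightarrow> 3"
  assumes "finite S" and "\<And>x y. x \<in> S \<Longrightarrow> y \<in> S \<Longrightarrow> x - y \<in> S"
    and "\<And>x y. x \<in> S \<Longrightarrow> y \<in> S \<Longrightarrow> h (x - y) = h x - h y"
  shows "card S \<le> 3 * card {x \<in> S. h x = 0}"
proof -
  have "card (h ` S) \<le> CARD(3)" by (rule card_mono) auto
  then show ?thesis
    using card_eq_card_kernel_times_card_image[of S h, OF assms] by simp
qed

section \<open>Invariant functions modulo 3\<close>

definition supported_funs :: "'a set \<Rightarrow> ('a \<Rightarrow> 3) set" where
  "supported_funs Y = {f. \<forall>x. x \<notin> Y \<longrightarrow> f x = 0}"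

definition odd_funs :: "int set \<Rightarrow> (int \<Rightarrow> 3) set" where
  "odd_funs Y = {f \<in> supported_funs Y. \<forall>x. f (- x) = - f x}"

definition fixed_funs :: "('a \<Rightarrow> 3) set \<Rightarrow> ('a \<Rightarrow> 'a) \<Rightarrow> ('a \<Rightarrow> 3) set" where
  "fixed_funs V a = {f \<in> V. f \<circ> a = f}"

definition difference_funs :: "'a set \<Rightarrow> ('a \<Rightarrow> 'a) \<Rightarrow> ('a \<Rightarrow> 3) set" where
  "difference_funs Y a = (\<lambda>f. (f \<circ> a) - f) ` supported_funs Y"

lemma finite_supported_funs: "finite Y \<Longrightarrow> finite (supported_funs Y)"
  using finite_set_of_finite_funs[of Y "UNIV::3 set" 0] by (simp add: supported_funs_def)

lemma finite_odd_funs: "finite Y \<Longrightarrow> finite (odd_funs Y)"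
  using finite_supported_funs[of Y] by (simp add: odd_funs_def)

lemma supported_funs_diff: "f \<in> supported_funs Y \<Longrightarrow> g \<in> supported_funs Y \<Longrightarrow> f - g \<in> supported_funs Y"
  by (simp add: supported_funs_def)

text \<open>
  The invariant functions are the kernel of \<open>f \<mapsto> f \<circ> a - f\<close>.
\<close>
lemma card_fixed_times_card_difference:
  assumes fin: "finite Y"
  shows "card (supported_funs Y) = card (fixed_funs (supported_funs Y) a) * card (difference_funs Y a)"
proof -
  have "card (supported_funs Y) = card {f \<in> supported_funs Y. (f \<circ> a) - f = 0} * card (difference_funs Y a)"
    unfolding difference_funs_def
    by (rule card_eq_card_kernel_times_card_image)
      (auto simp: finite_supported_funs fin supported_funs_diff fun_eq_iff)
  then show ?thesis by (simp add: fixed_funs_def)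
qed

section \<open>The genus inequality\<close>

text \<open>
  Transitivity of the group generated by two permutations of a finite set, in terms of invariant
  subsets only.
\<close>
locale transitive_pair =
  fixes Y :: "'a set" and a b :: "'a \<Rightarrow> 'a"
  assumes finite_Y: "finite Y" and nonempty: "Y \<noteq> {}"
    and a_mem: "\<And>x. a x \<in> Y \<longleftrightarrow> x \<in> Y" and b_mem: "\<And>x. b x \<in> Y \<longleftrightarrow> x \<in> Y"
    and inj_a: "inj a" and inj_b: "inj b"
    and transitive: "\<And>S. S \<subseteq> Y \<Longrightarrow> S \<noteq> {} \<Longrightarrow> a ` S \<subseteq> S \<Longrightarrow> b ` S \<subseteq> S \<Longrightarrow> S = Y"
begin

lemma invariant_funs_constant:
  assumes f: "f \<circ> a = f" "f \<circ> b = f" and p: "p \<in> Y" "q \<in> Y"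
  shows "f p = f q"
proof -
  have "f (a x) = f x" "f (b x) = f x" for x
    using f by (metis comp_apply)+
  then have "{x \<in> Y. f x = f p} = Y"
    using p a_mem b_mem by (intro transitive) auto
  then show ?thesis using p by force
qed

text \<open>
  Since \<open>f \<circ> (a \<circ> b) - f\<close> is the sum of \<open>(f \<circ> a - f) \<circ> b\<close> and \<open>f \<circ> b - f\<close>, this map
  sends the pair \<open>(f \<circ> a - f, f \<circ> b - f)\<close> to \<open>f \<circ> (a \<circ> b) - f\<close>. The twist by \<open>b\<close> in the first
  component does not change the range, which is the sum of the two groups of difference functions.
\<close>
definition difference_sum :: "('a \<Rightarrow> 3) \<times> ('a \<Rightarrow> 3) \<Rightarrow> ('a \<Rightarrow> 3)" where
  "difference_sum w = (fst w \<circ> b) + snd w"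

abbreviation "difference_sums \<equiv> difference_sum ` (difference_funs Y a \<times> difference_funs Y b)"

lemma difference_funs_subgroup:
  assumes "f \<in> difference_funs Y c" "g \<in> difference_funs Y c"
  shows "f - g \<in> difference_funs Y c"
proof -
  obtain f' g' where f: "f = (f' \<circ> c) - f'" "f' \<in> supported_funs Y"
    and g: "g = (g' \<circ> c) - g'" "g' \<in> supported_funs Y"
    using assms by (auto simp: difference_funs_def)
  have "f - g = ((f' - g') \<circ> c) - (f' - g')" unfolding f g by (simp add: fun_eq_iff)
  then show ?thesis using supported_funs_diff[OF f(2) g(2)] unfolding difference_funs_def by blast
qed

lemma zero_mem: "0 \<in> difference_funs Y c"
  unfolding difference_funs_def by (rule image_eqI[of _ _ 0]) (auto simp: supported_funs_def)

lemma difference_sums_diff: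
  assumes "u \<in> difference_sums" "v \<in> difference_sums"
  shows "u - v \<in> difference_sums"
proof -
  obtain w w' where w: "w \<in> difference_funs Y a \<times> difference_funs Y b" "u = difference_sum w"
    and w': "w' \<in> difference_funs Y a \<times> difference_funs Y b" "v = difference_sum w'"
    using assms by blast
  have "u - v = difference_sum (w - w')"
    unfolding w w' difference_sum_def by (simp add: fun_eq_iff)
  moreover have "fst w - fst w' \<in> difference_funs Y a" "snd w - snd w' \<in> difference_funs Y b"
    using w(1) w'(1) by (auto intro: difference_funs_subgroup)
  then have "w - w' \<in> difference_funs Y a \<times> difference_funs Y b"
    by (simp add: mem_Times_iff)
  ultimately show ?thesis by (rule image_eqI)
qed

lemma difference_sums_add:
  assumes u: "u \<in> difference_sums" and v: "v \<in> difference_sums"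
  shows "u + v \<in> difference_sums"
proof -
  have "v - v \<in> difference_sums" using v v by (rule difference_sums_diff)
  then have "v - v - v \<in> difference_sums" using v by (rule difference_sums_diff)
  with u have "u - (v - v - v) \<in> difference_sums" by (rule difference_sums_diff)
  then show ?thesis by simp
qed

lemma difference_b_mem: "w \<in> difference_funs Y b \<Longrightarrow> w \<in> difference_sums"
  by (rule image_eqI[of _ _ "(0, w)"]) (auto simp: zero_mem difference_sum_def fun_eq_iff)

lemma difference_a_supported: "w \<in> difference_funs Y a \<Longrightarrow> w \<in> supported_funs Y"
  by (auto simp: difference_funs_def supported_funs_def a_mem)

text \<open>
  The twist is undone by \<open>w = w \<circ> b - (w \<circ> b - w)\<close>, whose last term is a \<open>b\<close>-difference.
\<close>
lemma difference_a_mem: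
  assumes w: "w \<in> difference_funs Y a"
  shows "w \<in> difference_sums"
proof -
  have "(w \<circ> b) - w \<in> difference_funs Y b"
    using difference_a_supported[OF w] by (auto simp: difference_funs_def)
  then have "0 - ((w \<circ> b) - w) \<in> difference_funs Y b"
    using difference_funs_subgroup zero_mem by blast
  moreover have "w = difference_sum (w, 0 - ((w \<circ> b) - w))"
    by (simp add: difference_sum_def fun_eq_iff)
  ultimately show ?thesis using w by blast
qed

definition point_fun :: "'a \<Rightarrow> 3 \<Rightarrow> ('a \<Rightarrow> 3)" where
  "point_fun p c = (\<lambda>x. if x = p then c else 0)"

lemma point_fun_add: "point_fun p (c + d) = point_fun p c + point_fun p d"
  by (simp add: point_fun_def fun_eq_iff)

text \<open>
  Composing the point function at \<open>g q\<close> with \<open>g\<close> gives the one at \<open>q\<close>.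
\<close>
lemma point_fun_step:
  assumes g: "g = a \<or> g = b" and q: "q \<in> Y"
  shows "point_fun q c - point_fun (g q) c \<in> difference_sums"
proof -
  have inj: "inj g" and mem: "g q \<in> Y" using g inj_a inj_b q a_mem b_mem by auto
  have shift: "point_fun (g q) c \<circ> g = point_fun q c"
    using inj_eq[OF inj] by (simp add: point_fun_def fun_eq_iff)
  have "point_fun (g q) c \<in> supported_funs Y"
    using mem by (simp add: point_fun_def supported_funs_def)
  then have "(point_fun (g q) c \<circ> g) - point_fun (g q) c \<in> difference_funs Y g"
    unfolding difference_funs_def by (rule imageI)
  then have "point_fun q c - point_fun (g q) c \<in> difference_funs Y g" by (simp only: shift)
  then show ?thesis using g difference_a_mem difference_b_mem by metis
qed

lemma point_funs_congruent:
  assumes p: "p \<in> Y" and q: "q \<in> Y"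
  shows "point_fun p c - point_fun q c \<in> difference_sums"
proof -
  let ?S = "{x \<in> Y. point_fun p c - point_fun x c \<in> difference_sums}"
  have step: "g x \<in> ?S" if x: "x \<in> ?S" and g: "g = a \<or> g = b" for x g
  proof -
    have "(point_fun p c - point_fun x c) + (point_fun x c - point_fun (g x) c) \<in> difference_sums"
      using x point_fun_step[OF g, of x c] by (intro difference_sums_add) simp_all
    then have "point_fun p c - point_fun (g x) c \<in> difference_sums" by (simp only: add_diff_eq diff_add_cancel)
    moreover have "g x \<in> Y" using x g a_mem b_mem by auto
    ultimately show ?thesis by simp
  qed
  have "p \<in> ?S" using p difference_b_mem[OF zero_mem] by simp
  then have "?S \<noteq> {}" by blast
  moreover have "a ` ?S \<subseteq> ?S" "b ` ?S \<subseteq> ?S" using step by blast+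
  ultimately have "?S = Y" by (intro transitive) simp_all
  then show ?thesis using q by blast
qed

text \<open>
  By transitivity all points are equivalent modulo difference sums, so the mass of a function can
  be moved to a single point \<open>p\<close>: the quotient by the difference sums has at most 3 elements.
\<close>
lemma congruent_point_fun:
  assumes p: "p \<in> Y" and "finite T" "T \<subseteq> Y" "f \<in> supported_funs T"
  shows "\<exists>c. f - point_fun p c \<in> difference_sums"
  using assms(2-)
proof (induction T arbitrary: f rule: finite_induct)
  case empty
  then have "f - point_fun p 0 = 0" by (auto simp: supported_funs_def point_fun_def fun_eq_iff)
  then have "f - point_fun p 0 \<in> difference_sums" using difference_b_mem[OF zero_mem] by simp
  then show ?case by blast
next
  case (insert q T)
  have "f - point_fun q (f q) \<in> supported_funs T"
    using insert.prems insert.hyps by (auto simp: supported_funs_def point_fun_def)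
  then obtain c where c: "f - point_fun q (f q) - point_fun p c \<in> difference_sums"
    using insert by blast
  have "point_fun q (f q) - point_fun p (f q) \<in> difference_sums"
    using point_funs_congruent p insert.prems by blast
  from difference_sums_add[OF c this] have "f - point_fun p (c + f q) \<in> difference_sums"
    by (simp add: point_fun_add algebra_simps)
  then show ?case by blast
qed

lemma finite_difference: "finite (difference_funs Y c)"
  by (simp add: difference_funs_def finite_supported_funs finite_Y)

lemma card_supported_le_difference_sums: "card (supported_funs Y) \<le> 3 * card difference_sums"
proof -
  obtain p where p: "p \<in> Y" using nonempty by blast
  have "supported_funs Y \<subseteq> (\<lambda>(c, u). point_fun p c + u) ` (UNIV \<times> difference_sums)"
  proof
    fix f assume "f \<in> supported_funs Y"
    then obtain c where "f - point_fun p c \<in> difference_sums"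
      using congruent_point_fun[OF p finite_Y subset_refl] by blast
    then show "f \<in> (\<lambda>(c, u). point_fun p c + u) ` (UNIV \<times> difference_sums)"
      by (intro image_eqI[of _ _ "(c, f - point_fun p c)"]) auto
  qed
  moreover have fin: "finite ((UNIV :: 3 set) \<times> difference_sums)" using finite_difference by auto
  ultimately have "card (supported_funs Y) \<le> card ((UNIV :: 3 set) \<times> difference_sums)"
    using surj_card_le by blast
  then show ?thesis by (simp add: card_cartesian_product)
qed

text \<open>
  In terms of orbits this reads \<open>#(a) + #(b) + #(a \<circ> b) \<le> \<bar>Y\<bar> + 2\<close>, the Riemann--Hurwitz bound
  for transitive permutations. The argument is the one of Scott's lemma: in the sequence
  \<open>V \<rightarrow> D\<^sub>a \<times> D\<^sub>b \<rightarrow> V\<close> given by \<open>f \<mapsto> (f \<circ> a - f, f \<circ> b - f)\<close> and \<open>difference_sum\<close>, where \<open>D\<^sub>a\<close> and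
  \<open>D\<^sub>b\<close> are the groups of difference functions, the functions
  invariant under \<open>a \<circ> b\<close> are mapped into the kernel of the second map. Only constants are lost in
  the first map, and the second has a cokernel of size at most 3, so \<open>D\<^sub>a \<times> D\<^sub>b\<close> is large; but its
  size is \<open>\<bar>V\<bar>\<^sup>2\<close> divided by the numbers of \<open>a\<close>-invariant and \<open>b\<close>-invariant functions.
\<close>
lemma genus_inequality:
  "card (fixed_funs (supported_funs Y) a) * card (fixed_funs (supported_funs Y) b)
     * card (fixed_funs (supported_funs Y) (a \<circ> b)) \<le> 9 * card (supported_funs Y)"
proof -
  let ?V = "supported_funs Y"
  let ?W = "difference_funs Y a \<times> difference_funs Y b"
  let ?Fc = "fixed_funs ?V (a \<circ> b)"
  define \<beta> where "\<beta> f = ((f \<circ> a) - f, (f \<circ> b) - f)" for f :: "'a \<Rightarrow> 3"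
  have W: "card ?W = card {w \<in> ?W. difference_sum w = 0} * card difference_sums"
    by (rule card_eq_card_kernel_times_card_image)
      (auto simp: finite_difference difference_funs_subgroup difference_sum_def fun_eq_iff)
  have finFc: "finite ?Fc" using finite_supported_funs[OF finite_Y] by (simp add: fixed_funs_def)
  have "card ?Fc = card {f \<in> ?Fc. \<beta> f = 0} * card (\<beta> ` ?Fc)"
    by (rule card_eq_card_kernel_times_card_image[OF finFc])
      (auto simp: \<beta>_def fixed_funs_def supported_funs_diff fun_eq_iff)
  moreover have "card {f \<in> ?Fc. \<beta> f = 0} \<le> 3"
  proof -
    obtain p where p: "p \<in> Y" using nonempty by blast
    have "{f \<in> ?Fc. \<beta> f = 0} \<subseteq> (\<lambda>c x. if x \<in> Y then c else 0) ` UNIV"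
    proof
      fix f assume f: "f \<in> {f \<in> ?Fc. \<beta> f = 0}"
      then have "f \<circ> a = f" "f \<circ> b = f" by (auto simp: \<beta>_def zero_prod_def)
      then have "f x = f p" if "x \<in> Y" for x using invariant_funs_constant p that by blast
      then have "f = (\<lambda>x. if x \<in> Y then f p else 0)"
        using f by (auto simp: fixed_funs_def supported_funs_def fun_eq_iff)
      then show "f \<in> (\<lambda>c x. if x \<in> Y then c else 0) ` UNIV" by blast
    qed
    from surj_card_le[OF _ this] show ?thesis by simp
  qed
  moreover have "card (\<beta> ` ?Fc) \<le> card {w \<in> ?W. difference_sum w = 0}"
  proof (rule card_mono)
    show "finite {w \<in> ?W. difference_sum w = 0}" using finite_difference by simp
    show "\<beta> ` ?Fc \<subseteq> {w \<in> ?W. difference_sum w = 0}"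
      by (auto simp: \<beta>_def fixed_funs_def difference_funs_def difference_sum_def fun_eq_iff)
  qed
  ultimately have "card ?Fc \<le> 3 * card {w \<in> ?W. difference_sum w = 0}"
    by (simp only: mult_le_mono)
  then have "card ?Fc * card ?V
      \<le> (3 * card {w \<in> ?W. difference_sum w = 0}) * (3 * card difference_sums)"
    using card_supported_le_difference_sums by (rule mult_le_mono)
  also have "\<dots> = 9 * (card (difference_funs Y a) * card (difference_funs Y b))"
    using W by (simp add: card_cartesian_product)
  finally have "card (fixed_funs ?V a) * card (fixed_funs ?V b) * (card ?Fc * card ?V)
      \<le> card (fixed_funs ?V a) * card (fixed_funs ?V b)
         * (9 * (card (difference_funs Y a) * card (difference_funs Y b)))"
    by (rule mult_le_mono2)
  also have "\<dots> = 9 * card ?V * card ?V"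
    using card_fixed_times_card_difference[OF finite_Y, of a]
      card_fixed_times_card_difference[OF finite_Y, of b] by simp
  finally have "(card (fixed_funs ?V a) * card (fixed_funs ?V b) * card ?Fc) * card ?V
      \<le> (9 * card ?V) * card ?V"
    by (simp add: ac_simps)
  moreover have "card ?V > 0"
  proof -
    have "0 \<in> ?V" by (simp add: supported_funs_def)
    then show ?thesis using finite_supported_funs[OF finite_Y] card_gt_0_iff by blast
  qed
  ultimately show ?thesis by simp
qed

end

section \<open>Odd functions and orbit counts\<close>

text \<open>
  A function is determined by its odd and its even part, and multiplication by the sign turns even
  functions on a set without 0 into odd ones.
\<close>
lemma card_supported_le_odd_squared:
  assumes fin: "finite Y" and sym: "\<And>x. - x \<in> Y \<longleftrightarrow> x \<in> Y" and "0 \<notin> Y"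
  shows "card (supported_funs Y) \<le> (card (odd_funs Y))\<^sup>2"
proof -
  define s :: "int \<Rightarrow> 3" where "s x = of_int (sgn x)" for x
  have s_odd: "s (- x) = - s x" for x by (simp add: s_def)
  have s_square: "s x * s x = 1" if "x \<noteq> 0" for x
    using that by (cases "x > 0") (simp_all add: s_def)
  define \<Phi> where "\<Phi> f = (\<lambda>x. f x - f (- x), \<lambda>x. s x * (f x + f (- x)))" for f :: "int \<Rightarrow> 3"
  have "inj_on \<Phi> (supported_funs Y)"
  proof (rule inj_onI, rule ext)
    fix f g x assume f: "f \<in> supported_funs Y" and g: "g \<in> supported_funs Y" and eq: "\<Phi> f = \<Phi> g"
    show "f x = g x"
    proof (cases "x \<in> Y")
      case True
      then have "x \<noteq> 0" using \<open>0 \<notin> Y\<close> by auto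
      have diff: "f x - f (- x) = g x - g (- x)"
        and "s x * (f x + f (- x)) = s x * (g x + g (- x))"
        using eq by (auto simp: \<Phi>_def fun_eq_iff)
      then have "s x * s x * (f x + f (- x)) = s x * s x * (g x + g (- x))"
        by (simp only: mult.assoc)
      then have "f x + f (- x) = g x + g (- x)" using s_square[OF \<open>x \<noteq> 0\<close>] by simp
      then have "(f x + f (- x)) + (f x - f (- x)) = (g x + g (- x)) + (g x - g (- x))"
        using diff by simp
      then have "f x + f x = g x + g x" by (simp add: algebra_simps)
      then show ?thesis by (rule mod3_double_eq)
    next
      case False
      then show ?thesis using f g by (simp add: supported_funs_def)
    qed
  qed
  moreover have "\<Phi> ` supported_funs Y \<subseteq> odd_funs Y \<times> odd_funs Y"
    by (auto simp: \<Phi>_def odd_funs_def supported_funs_def sym s_odd add.commute)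
  ultimately have "card (supported_funs Y) \<le> card (odd_funs Y \<times> odd_funs Y)"
    using finite_odd_funs[OF fin] by (intro card_inj_on_le) auto
  then show ?thesis by (simp add: card_cartesian_product power2_eq_square)
qed

lemma invariant_fun_on_orbit:
  assumes "f \<circ> a = f" "y \<in> Orbits.orbit a x" shows "f y = f x"
proof -
  have step: "f (a z) = f z" for z using assms(1) by (metis comp_apply)
  from assms(2) show ?thesis by induction (simp_all add: step)
qed

text \<open>
  As above, a twist by signs makes an odd function even, but now the sign \<open>\<epsilon>\<close> has to be
  \<open>a\<close>-invariant. Such a sign exists on the points whose orbit is not inversion-invariant: it
  tells which of two opposite orbits has the larger maximum. Elsewhere it is zero, which is
  harmless because odd invariant functions vanish there as well. So adding to one odd invariant
  function the \<open>\<epsilon>\<close>-twist of another loses no information.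
\<close>
lemma card_fixed_odd_squared_le:
  assumes fin: "finite Y" and a: "permutation a" and a_odd: "\<And>x. a (- x) = - a x"
  shows "(card (fixed_funs (odd_funs Y) a))\<^sup>2 \<le> card (fixed_funs (supported_funs Y) a)"
proof -
  define \<epsilon> :: "int \<Rightarrow> 3" where
    "\<epsilon> x = of_int (sgn (Max (Orbits.orbit a x) - Max (Orbits.orbit a (- x))))" for x
  have \<epsilon>_odd: "\<epsilon> (- x) = - \<epsilon> x" for x
  proof -
    have "sgn (u - v) = - sgn (v - u)" for u v :: int by (simp add: sgn_if)
    from this[of "Max (Orbits.orbit a (- x))"] show ?thesis by (simp add: \<epsilon>_def)
  qed
  have \<epsilon>_inv: "\<epsilon> (a x) = \<epsilon> x" for x
    using permutation_orbit_step[OF a, of x] permutation_orbit_step[OF a, of "- x"]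
    by (simp add: \<epsilon>_def a_odd)
  have Max_mem: "Max (Orbits.orbit a x) \<in> Orbits.orbit a x" for x
    using finite_orbit[OF permutation_self_in_orbit[OF a]] orbit_nonempty by (intro Max_in)
  have \<epsilon>_zero: "f x = 0" if f: "f \<in> fixed_funs (odd_funs Y) a" and "\<epsilon> x = 0" for f x
  proof -
    have "Max (Orbits.orbit a x) = Max (Orbits.orbit a (- x))"
      using \<open>\<epsilon> x = 0\<close> by (auto simp: \<epsilon>_def sgn_if split: if_splits)
    moreover have "f \<circ> a = f" using f by (simp add: fixed_funs_def)
    ultimately have "f x = f (- x)"
      using invariant_fun_on_orbit[OF _ Max_mem] by metis
    then have "f x = - f x" using f by (simp add: fixed_funs_def odd_funs_def)
    then show ?thesis by (rule mod3_eq_uminus_self)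
  qed
  define \<Phi> where "\<Phi> p = (\<lambda>x. fst p x + \<epsilon> x * snd p x)" for p :: "(int \<Rightarrow> 3) \<times> (int \<Rightarrow> 3)"
  have "inj_on \<Phi> (fixed_funs (odd_funs Y) a \<times> fixed_funs (odd_funs Y) a)"
  proof (rule inj_onI)
    fix p q assume p: "p \<in> fixed_funs (odd_funs Y) a \<times> fixed_funs (odd_funs Y) a"
      and q: "q \<in> fixed_funs (odd_funs Y) a \<times> fixed_funs (odd_funs Y) a" and eq: "\<Phi> p = \<Phi> q"
    have comps: "fst p x = fst q x \<and> snd p x = snd q x" for x
    proof -
      have odd: "fst p (- x) = - fst p x" "snd p (- x) = - snd p x"
        "fst q (- x) = - fst q x" "snd q (- x) = - snd q x"
        using p q by (auto simp: mem_Times_iff fixed_funs_def odd_funs_def)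
      have eq1: "fst p x + \<epsilon> x * snd p x = fst q x + \<epsilon> x * snd q x"
        using fun_cong[OF eq, of x] by (simp add: \<Phi>_def)
      have eq2: "- fst p x + \<epsilon> x * snd p x = - fst q x + \<epsilon> x * snd q x"
        using fun_cong[OF eq, of "- x"] by (simp add: \<Phi>_def odd \<epsilon>_odd)
      have "(fst p x + \<epsilon> x * snd p x) - (- fst p x + \<epsilon> x * snd p x)
          = (fst q x + \<epsilon> x * snd q x) - (- fst q x + \<epsilon> x * snd q x)"
        by (simp only: eq1 eq2)
      then have "fst p x + fst p x = fst q x + fst q x" by simp
      then have first: "fst p x = fst q x" by (rule mod3_double_eq)
      then have "\<epsilon> x * snd p x = \<epsilon> x * snd q x" using eq1 by simp
      then have "snd p x = snd q x"
        using mod3_cases[of "\<epsilon> x"] \<epsilon>_zero[of "snd p" x] \<epsilon>_zero[of "snd q" x] p q by auto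
      with first show ?thesis by simp
    qed
    then show "p = q" by (simp add: prod_eq_iff fun_eq_iff)
  qed
  moreover have "\<Phi> ` (fixed_funs (odd_funs Y) a \<times> fixed_funs (odd_funs Y) a)
      \<subseteq> fixed_funs (supported_funs Y) a"
    by (auto simp: \<Phi>_def fixed_funs_def odd_funs_def supported_funs_def fun_eq_iff \<epsilon>_inv)
  moreover have "finite (fixed_funs (supported_funs Y) a)"
    using finite_supported_funs[OF fin] by (simp add: fixed_funs_def)
  ultimately have "card (fixed_funs (odd_funs Y) a \<times> fixed_funs (odd_funs Y) a)
      \<le> card (fixed_funs (supported_funs Y) a)"
    by (rule card_inj_on_le)
  then show ?thesis by (simp add: card_cartesian_product power2_eq_square)
qed

text \<open>
  A value modulo 3 can be chosen freely on each orbit.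
\<close>
lemma power3_num_orbits_le:
  assumes fin: "finite Y" and a: "permutation a" and a_mem: "\<And>x. a x \<in> Y \<longleftrightarrow> x \<in> Y"
  shows "3 ^ num_orbits a Y \<le> card (fixed_funs (supported_funs Y) a)"
proof -
  define \<Phi> where "\<Phi> \<phi> = (\<lambda>x. if x \<in> Y then \<phi> (Orbits.orbit a x) else 0)" for \<phi> :: "int set \<Rightarrow> 3"
  let ?E = "perm_orbits a Y \<rightarrow>\<^sub>E (UNIV :: 3 set)"
  have "inj_on \<Phi> ?E"
  proof (rule inj_onI)
    fix \<phi> \<psi> assume \<phi>: "\<phi> \<in> ?E" and \<psi>: "\<psi> \<in> ?E" and eq: "\<Phi> \<phi> = \<Phi> \<psi>"
    show "\<phi> = \<psi>"
    proof (rule PiE_ext[OF \<phi> \<psi>])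
      fix A assume "A \<in> perm_orbits a Y"
      then obtain x where x: "x \<in> Y" "A = Orbits.orbit a x" by (auto simp: perm_orbits_def)
      then show "\<phi> A = \<psi> A" using fun_cong[OF eq, of x] by (simp add: \<Phi>_def)
    qed
  qed
  moreover have "\<Phi> ` ?E \<subseteq> fixed_funs (supported_funs Y) a"
    by (auto simp: \<Phi>_def fixed_funs_def supported_funs_def fun_eq_iff a_mem permutation_orbit_step[OF a])
  moreover have "finite (fixed_funs (supported_funs Y) a)"
    using finite_supported_funs[OF fin] by (simp add: fixed_funs_def)
  ultimately have "card ?E \<le> card (fixed_funs (supported_funs Y) a)"
    by (rule card_inj_on_le)
  moreover have "finite (perm_orbits a Y)" using fin by (simp add: perm_orbits_def)
  ultimately show ?thesis by (simp add: card_PiE num_orbits_def)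
qed

section \<open>Reflection length and invariant odd functions\<close>

lemma finite_signed_points: "finite (signed_points n)"
  by (simp add: signed_points_def)

text \<open>
  The values of an odd function at the positive points are arbitrary.
\<close>
lemma power3_le_card_odd_signed_points: "3 ^ n \<le> card (odd_funs (signed_points n))"
proof -
  define \<Phi> where "\<Phi> \<phi> = (\<lambda>x. if x \<in> {1..int n} then \<phi> x else if - x \<in> {1..int n} then - \<phi> (- x) else 0)"
    for \<phi> :: "int \<Rightarrow> 3"
  let ?E = "{1..int n} \<rightarrow>\<^sub>E (UNIV :: 3 set)"
  have "inj_on \<Phi> ?E"
  proof (rule inj_onI)
    fix \<phi> \<psi> assume \<phi>: "\<phi> \<in> ?E" and \<psi>: "\<psi> \<in> ?E" and eq: "\<Phi> \<phi> = \<Phi> \<psi>"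
    show "\<phi> = \<psi>"
    proof (rule PiE_ext[OF \<phi> \<psi>])
      fix x assume "x \<in> {1..int n}"
      then show "\<phi> x = \<psi> x" using fun_cong[OF eq, of x] by (simp add: \<Phi>_def)
    qed
  qed
  moreover have "\<Phi> ` ?E \<subseteq> odd_funs (signed_points n)"
    by (auto simp: \<Phi>_def odd_funs_def supported_funs_def signed_points_def)
  ultimately have "card ?E \<le> card (odd_funs (signed_points n))"
    using finite_odd_funs[OF finite_signed_points] by (rule card_inj_on_le)
  then show ?thesis by (simp add: card_PiE)
qed

text \<open>
  A generator exchanges two points \<open>i\<close> and \<open>j\<close> and likewise their negatives, so for an odd function
  equality of the values at \<open>i\<close> and \<open>j\<close> is all that invariance requires.
\<close>
lemma type_B_generator_one_condition:
  assumes "t \<in> type_B_generators n"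
  obtains i j where "\<And>f :: int \<Rightarrow> 3. (\<And>x. f (- x) = - f x) \<Longrightarrow> f i = f j \<Longrightarrow> f \<circ> t = f"
proof -
  have two: "f \<circ> (transpose i j \<circ> transpose (- i) (- j)) = f"
    if f: "\<And>x. f (- x) = - f x" and "f i = f j" for f :: "int \<Rightarrow> 3" and i j
  proof -
    have tr: "f (transpose u v x) = f x" if "f u = f v" for u v x
      using that by (auto simp: transpose_def)
    have "f (- i) = f (- j)" using that by simp
    then show ?thesis using \<open>f i = f j\<close> by (simp add: fun_eq_iff tr)
  qed
  have one: "f \<circ> transpose i (- i) = f" if "f i = f (- i)" for f :: "int \<Rightarrow> 3" and i
    using that by (auto simp: fun_eq_iff transpose_def)
  from assms consider i j where "t = transpose i j \<circ> transpose (- i) (- j)"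
    | i j where "t = transpose i (- j) \<circ> transpose (- i) j" | i where "t = transpose i (- i)"
    by (auto simp: type_B_generators_def)
  then show thesis
  proof cases
    case (1 i j) then show thesis using that[of i j] two by blast
  next
    case (2 i j) then show thesis using that[of i "- j"] two[of _ i "- j"] by simp
  next
    case (3 i) then show thesis using that[of i "- i"] one by blast
  qed
qed

text \<open>
  Each generator imposes one linear condition and so divides the number of functions by at most 3.
\<close>
lemma card_odd_le_card_common_fixed:
  assumes fin: "finite P" and "set ts \<subseteq> type_B_generators n"
  shows "card (odd_funs P) \<le> 3 ^ length ts * card {f \<in> odd_funs P. \<forall>t\<in>set ts. f \<circ> t = f}"
  using assms(2)
proof (induction ts)
  case (Cons t ts)
  let ?F = "{f \<in> odd_funs P. \<forall>t\<in>set ts. f \<circ> t = f}"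
  obtain i j where t: "\<And>f :: int \<Rightarrow> 3. (\<And>x. f (- x) = - f x) \<Longrightarrow> f i = f j \<Longrightarrow> f \<circ> t = f"
    using type_B_generator_one_condition Cons.prems by (metis list.set_intros(1) subsetD)
  have finF: "finite ?F" using finite_odd_funs[OF fin] by simp
  have "card ?F \<le> 3 * card {f \<in> ?F. f i - f j = 0}"
    by (rule card_le_3_times_card_kernel[OF finF])
      (auto simp: odd_funs_def supported_funs_diff fun_eq_iff)
  also have "card {f \<in> ?F. f i - f j = 0} \<le> card {f \<in> odd_funs P. \<forall>t\<in>set (t # ts). f \<circ> t = f}"
  proof (rule card_mono)
    show "finite {f \<in> odd_funs P. \<forall>t\<in>set (t # ts). f \<circ> t = f}" using finite_odd_funs[OF fin] by simp
    show "{f \<in> ?F. f i - f j = 0} \<subseteq> {f \<in> odd_funs P. \<forall>t\<in>set (t # ts). f \<circ> t = f}"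
      using t by (auto simp: odd_funs_def)
  qed
  finally have "3 ^ length ts * card ?F
      \<le> 3 ^ length ts * (3 * card {f \<in> odd_funs P. \<forall>t\<in>set (t # ts). f \<circ> t = f})"
    by simp
  moreover have "card (odd_funs P) \<le> 3 ^ length ts * card ?F"
    using Cons.prems by (intro Cons.IH) simp
  ultimately show ?case by (simp only: list.size power_Suc2 add_0_right add_Suc_right mult.assoc)
qed simp

lemma card_odd_le_card_fixed_product:
  assumes fin: "finite P" and ts: "set ts \<subseteq> type_B_generators n"
  shows "card (odd_funs P) \<le> 3 ^ length ts * card (fixed_funs (odd_funs P) (foldr (\<circ>) ts id))"
proof -
  have "f \<circ> foldr (\<circ>) ts id = f" if "\<forall>t\<in>set ts. f \<circ> t = f" for f :: "int \<Rightarrow> 3"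
    using that by (induction ts) (simp_all add: comp_assoc[symmetric])
  then have "card {f \<in> odd_funs P. \<forall>t\<in>set ts. f \<circ> t = f} \<le> card (fixed_funs (odd_funs P) (foldr (\<circ>) ts id))"
    using finite_odd_funs[OF fin] by (intro card_mono) (auto simp: fixed_funs_def)
  then have "3 ^ length ts * card {f \<in> odd_funs P. \<forall>t\<in>set ts. f \<circ> t = f}
      \<le> 3 ^ length ts * card (fixed_funs (odd_funs P) (foldr (\<circ>) ts id))" by simp
  with card_odd_le_card_common_fixed[OF assms] show ?thesis by (rule le_trans)
qed

lemma hyperoctahedral_simps:
  "mult (hyperoctahedral_group n) = (\<circ>)" "one (hyperoctahedral_group n) = id"
  by (simp_all add: hyperoctahedral_group_def)

lemma hyperoctahedral_permutes:
  "\<tau> \<in> carrier (hyperoctahedral_group n) \<Longrightarrow> \<tau> permutes signed_points n"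
  by (simp add: hyperoctahedral_group_def)

lemma carrier_hyperoctahedralI:
  "\<tau> permutes signed_points n \<Longrightarrow> (\<And>x. \<tau> (- x) = - \<tau> x) \<Longrightarrow> \<tau> \<in> carrier (hyperoctahedral_group n)"
  by (simp add: hyperoctahedral_group_def)

text \<open>
  If the second index may be negative, the two families \<open>(i, j)(-i, -j)\<close> and \<open>(i, -j)(-i, j)\<close> become
  one, and every other signed point \<open>j\<close>, including \<open>-i\<close>, can be moved to \<open>i\<close> by a single generator.
\<close>
lemma type_B_generator_moving:
  assumes i: "i \<in> {1..int n}" and j: "j \<in> signed_points n" and "i \<noteq> j"
  obtains t where "t \<in> type_B_generators n" "t \<in> carrier (hyperoctahedral_group n)" "t \<circ> t = id"
    "t j = i" "\<And>x. x \<notin> {i, - i, j, - j} \<Longrightarrow> t x = x"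
proof (cases "j = - i")
  case True
  show thesis
  proof (rule that[of "transpose i (- i)"])
    show "transpose i (- i) \<in> type_B_generators n" using i by (auto simp: type_B_generators_def)
    show "transpose i (- i) \<in> carrier (hyperoctahedral_group n)"
      using i by (intro carrier_hyperoctahedralI permutes_swap_id)
        (auto simp: signed_points_def transpose_def)
  qed (use True i in \<open>auto simp: transpose_def fun_eq_iff\<close>)
next
  case False
  let ?t = "transpose i j \<circ> transpose (- i) (- j)"
  have nz: "j \<noteq> 0" "i > 0" using i j by (auto simp: signed_points_def)
  show thesis
  proof (rule that[of ?t])
    show "?t \<in> type_B_generators n"
    proof (cases "j > 0")
      case True
      then have "j \<in> {1..int n}" using j by (auto simp: signed_points_def)
      then show ?thesis using i \<open>i \<noteq> j\<close> unfolding type_B_generators_def by blast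
    next
      case neg: False
      then have "- j \<in> {1..int n}" using j nz by (auto simp: signed_points_def)
      moreover have "?t = transpose i (- (- j)) \<circ> transpose (- i) (- j)" by simp
      moreover have "i \<noteq> - j" using False by simp
      ultimately show ?thesis using i unfolding type_B_generators_def by blast
    qed
    show "?t \<in> carrier (hyperoctahedral_group n)"
    proof (rule carrier_hyperoctahedralI)
      show "?t permutes signed_points n"
        using i j by (intro permutes_compose permutes_swap_id) (auto simp: signed_points_def)
    qed (use \<open>i \<noteq> j\<close> False nz in \<open>auto simp: transpose_def\<close>)
  qed (use \<open>i \<noteq> j\<close> False nz in \<open>auto simp: transpose_def fun_eq_iff\<close>)
qed

text \<open>
  If \<open>\<tau>\<close> moves \<open>i\<close> to \<open>j\<close>, then composing it with the generator exchanging \<open>i\<close> and \<open>j\<close> fixes \<open>i\<close>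
  and unfixes nothing, because \<open>j\<close> is not a fixed point of \<open>\<tau>\<close> either.
\<close>
lemma product_of_generators:
  assumes "\<tau> \<in> carrier (hyperoctahedral_group n)"
  shows "\<exists>ts. length ts \<le> card {i \<in> {1..int n}. \<tau> i \<noteq> i} \<and> set ts \<subseteq> type_B_generators n \<and> \<tau> = foldr (\<circ>) ts id"
  using assms
proof (induction "card {i \<in> {1..int n}. \<tau> i \<noteq> i}" arbitrary: \<tau> rule: less_induct)
  case less
  interpret G: group "hyperoctahedral_group n" by (rule group_hyperoctahedral)
  let ?moved = "\<lambda>\<tau>. {i \<in> {1..int n}. \<tau> i \<noteq> i}"
  note odd = hyperoctahedral_odd[OF less.prems]
  note perm = hyperoctahedral_permutes[OF less.prems]
  show ?case
  proof (cases "?moved \<tau> = {}")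
    case True
    have "\<tau> x = x" for x
    proof -
      have "x \<in> {1..int n} \<or> - x \<in> {1..int n} \<or> x \<notin> signed_points n"
        by (auto simp: signed_points_def)
      then show ?thesis
        using True odd[of x] permutes_not_in[OF perm] by (elim disjE) auto
    qed
    then show ?thesis by (intro exI[of _ "[]"]) auto
  next
    case False
    then obtain i where i: "i \<in> {1..int n}" "\<tau> i \<noteq> i" by blast
    define j where "j = \<tau> i"
    have j: "j \<in> signed_points n"
      unfolding j_def using i(1) permutes_in_image[OF perm] by (auto simp: signed_points_def)
    obtain t where t: "t \<in> type_B_generators n" "t \<in> carrier (hyperoctahedral_group n)" "t \<circ> t = id"
      "t j = i" "\<And>x. x \<notin> {i, - i, j, - j} \<Longrightarrow> t x = x"
      using type_B_generator_moving[OF i(1) j] i(2) j_def by metis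
    have mem: "t \<circ> \<tau> \<in> carrier (hyperoctahedral_group n)"
      using G.m_closed[OF t(2) less.prems] by (simp add: hyperoctahedral_simps)
    have "?moved (t \<circ> \<tau>) \<subset> ?moved \<tau>"
    proof
      show "?moved (t \<circ> \<tau>) \<subseteq> ?moved \<tau>"
      proof
        fix p assume p: "p \<in> ?moved (t \<circ> \<tau>)"
        have "\<tau> p \<noteq> p"
        proof
          assume fix_p: "\<tau> p = p"
          then have "\<tau> (- p) = - p" by (simp add: odd)
          with fix_p have "p \<notin> {i, - i}" using i(2) by auto
          moreover have "p \<noteq> j" "p \<noteq> - j"
            using fix_p \<open>\<tau> (- p) = - p\<close> i(2) permutes_inj[OF perm] unfolding j_def
            by (metis injD, metis injD minus_minus)
          ultimately have "t p = p" using t(5) by auto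
          then show False using p fix_p by simp
        qed
        then show "p \<in> ?moved \<tau>" using p by simp
      qed
      show "?moved (t \<circ> \<tau>) \<noteq> ?moved \<tau>" using i t(4) j_def by auto
    qed
    then have smaller: "card (?moved (t \<circ> \<tau>)) < card (?moved \<tau>)"
      by (intro psubset_card_mono finite_subset[of "?moved \<tau>" "{1..int n}"]) auto
    then obtain ts where ts: "length ts \<le> card (?moved (t \<circ> \<tau>))" "set ts \<subseteq> type_B_generators n"
      "t \<circ> \<tau> = foldr (\<circ>) ts id"
      using less.hyps[OF _ mem] by blast
    have "\<tau> = t \<circ> (t \<circ> \<tau>)" using t(3) by (simp add: comp_assoc[symmetric])
    then have "\<tau> = foldr (\<circ>) (t # ts) id" using ts(3) by simp
    moreover have "length (t # ts) \<le> card (?moved \<tau>)" using ts(1) smaller by simp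
    moreover have "set (t # ts) \<subseteq> type_B_generators n" using ts(2) t(1) by simp
    ultimately show ?thesis by blast
  qed
qed

text \<open>
  A least length exists only because the generators generate the group.
\<close>
lemma type_B_length_attained:
  assumes "\<tau> \<in> carrier (hyperoctahedral_group n)"
  shows "type_B_length n \<tau> \<le> n"
    and "\<exists>ts. length ts = type_B_length n \<tau> \<and> set ts \<subseteq> type_B_generators n \<and> \<tau> = foldr (\<circ>) ts id"
proof -
  let ?P = "\<lambda>k. \<exists>ts. length ts = k \<and> set ts \<subseteq> type_B_generators n \<and> \<tau> = foldr (\<circ>) ts id"
  have len: "type_B_length n \<tau> = (LEAST k. ?P k)"
    by (simp add: type_B_length_def hyperoctahedral_simps)
  obtain ts where ts: "length ts \<le> card {i \<in> {1..int n}. \<tau> i \<noteq> i}" "set ts \<subseteq> type_B_generators n"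
    "\<tau> = foldr (\<circ>) ts id"
    using product_of_generators[OF assms] by blast
  have "card {i \<in> {1..int n}. \<tau> i \<noteq> i} \<le> card {1..int n}" by (intro card_mono) auto
  then have "length ts \<le> n" using ts(1) by simp
  moreover have P: "?P (length ts)" using ts by blast
  ultimately show "type_B_length n \<tau> \<le> n" using Least_le[of ?P, OF P] len by simp
  show "?P (type_B_length n \<tau>)" unfolding len by (rule LeastI[of ?P, OF P])
qed

lemma card_odd_le_power3_length:
  assumes "\<tau> \<in> carrier (hyperoctahedral_group n)" and "finite P"
  shows "card (odd_funs P) \<le> 3 ^ type_B_length n \<tau> * card (fixed_funs (odd_funs P) \<tau>)"
  using type_B_length_attained(2)[OF assms(1)] card_odd_le_card_fixed_product[OF assms(2)] by metis

section \<open>Decomposition of odd functions\<close>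

lemma inversion_invariant_orbit_kills_odd:
  fixes f :: "int \<Rightarrow> 3"
  assumes f: "\<And>x. f (- x) = - f x" "f \<circ> \<gamma> = f"
    and x: "x \<in> Orbits.orbit \<gamma> x" and ii: "inversion_invariant (Orbits.orbit \<gamma> x)"
  shows "f x = 0"
proof -
  have "- x \<in> Orbits.orbit \<gamma> x" using x ii by (auto simp: inversion_invariant_def)
  then have "f x = - f x" using invariant_fun_on_orbit[OF f(2)] f(1) by metis
  then show ?thesis by (rule mod3_eq_uminus_self)
qed

text \<open>
  Addition of an \<open>a\<close>-invariant and a \<open>b\<close>-invariant function is injective: if two sums agree, the
  difference of the first summands is invariant under \<open>a\<close> and \<open>b\<close>, hence zero. By cardinality it
  is then also surjective.
\<close>
lemma odd_funs_decompose:
  assumes fin: "finite P"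
    and large: "card (odd_funs P) \<le> card (fixed_funs (odd_funs P) a) * card (fixed_funs (odd_funs P) b)"
    and trivial: "\<And>f. f \<in> odd_funs P \<Longrightarrow> f \<circ> (a \<circ> b) = f \<Longrightarrow> f = 0"
    and h: "h \<in> odd_funs P"
  shows "\<exists>f\<in>fixed_funs (odd_funs P) a. \<exists>g\<in>fixed_funs (odd_funs P) b. h = f + g"
proof -
  let ?A = "fixed_funs (odd_funs P) a" and ?B = "fixed_funs (odd_funs P) b"
  let ?sum = "\<lambda>(f :: int \<Rightarrow> 3, g). f + g"
  have "inj_on ?sum (?A \<times> ?B)"
  proof (rule inj_onI)
    fix p q assume p: "p \<in> ?A \<times> ?B" and q: "q \<in> ?A \<times> ?B" and "?sum p = ?sum q"
    then have sums: "fst p + snd p = fst q + snd q" by (simp add: case_prod_beta)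
    have "fst p - fst q = (fst p + snd p) - (fst q + snd p)" by simp
    also have "\<dots> = snd q - snd p" unfolding sums by simp
    finally have alt: "fst p - fst q = snd q - snd p" .
    have "(fst p - fst q) \<circ> a = fst p - fst q"
      using p q by (auto simp: fixed_funs_def fun_eq_iff)
    moreover have "(fst p - fst q) \<circ> b = fst p - fst q"
      unfolding alt using p q by (auto simp: fixed_funs_def fun_eq_iff)
    ultimately have "(fst p - fst q) \<circ> (a \<circ> b) = fst p - fst q" by (simp only: comp_assoc[symmetric])
    moreover have "fst p - fst q \<in> odd_funs P"
      using p q by (auto simp: fixed_funs_def odd_funs_def supported_funs_def)
    ultimately have "fst p - fst q = 0" using trivial by blast
    then show "p = q" using alt by (simp add: prod_eq_iff)
  qed
  then have "card (?sum ` (?A \<times> ?B)) = card ?A * card ?B"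
    by (simp add: card_image card_cartesian_product)
  moreover have "?sum ` (?A \<times> ?B) \<subseteq> odd_funs P"
    by (auto simp: fixed_funs_def odd_funs_def supported_funs_def)
  ultimately have "?sum ` (?A \<times> ?B) = odd_funs P"
    using finite_odd_funs[OF fin] large by (intro card_seteq) simp_all
  then have "h \<in> ?sum ` (?A \<times> ?B)" using h by simp
  then show ?thesis by auto
qed

text \<open>
  Cutting the two summands off outside an invariant set keeps them invariant, so an odd function
  on \<open>Y\<close> has summands on \<open>Y\<close>.
\<close>
lemma card_odd_le_on_invariant_subset:
  assumes fin: "finite P"
    and decompose: "\<And>h. h \<in> odd_funs P \<Longrightarrow>
      \<exists>f\<in>fixed_funs (odd_funs P) a. \<exists>g\<in>fixed_funs (odd_funs P) b. h = f + g"
    and "Y \<subseteq> P" and sym: "\<And>x. - x \<in> Y \<longleftrightarrow> x \<in> Y"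
    and a_mem: "\<And>x. a x \<in> Y \<longleftrightarrow> x \<in> Y" and b_mem: "\<And>x. b x \<in> Y \<longleftrightarrow> x \<in> Y"
  shows "card (odd_funs Y) \<le> card (fixed_funs (odd_funs Y) a) * card (fixed_funs (odd_funs Y) b)"
proof -
  let ?A = "fixed_funs (odd_funs Y) a" and ?B = "fixed_funs (odd_funs Y) b"
  let ?sum = "\<lambda>(f :: int \<Rightarrow> 3, g). f + g"
  define cut :: "(int \<Rightarrow> 3) \<Rightarrow> (int \<Rightarrow> 3)" where "cut f = (\<lambda>x. if x \<in> Y then f x else 0)" for f
  have cut_fixed: "cut f \<in> fixed_funs (odd_funs Y) c"
    if "f \<in> fixed_funs (odd_funs P) c" "\<And>x. c x \<in> Y \<longleftrightarrow> x \<in> Y" for f c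
    using that by (auto simp: cut_def fixed_funs_def odd_funs_def supported_funs_def fun_eq_iff sym)
  have "odd_funs Y \<subseteq> ?sum ` (?A \<times> ?B)"
  proof
    fix h assume h: "h \<in> odd_funs Y"
    then have "h \<in> odd_funs P" using \<open>Y \<subseteq> P\<close> by (auto simp: odd_funs_def supported_funs_def)
    then obtain f g where f: "f \<in> fixed_funs (odd_funs P) a" and g: "g \<in> fixed_funs (odd_funs P) b"
      and "h = f + g" using decompose by blast
    then have "h = ?sum (cut f, cut g)"
      using h by (auto simp: cut_def odd_funs_def supported_funs_def fun_eq_iff)
    then show "h \<in> ?sum ` (?A \<times> ?B)"
      using cut_fixed[OF f a_mem] cut_fixed[OF g b_mem] by (metis (no_types, lifting) SigmaI image_eqI)
  qed
  moreover have "finite (?A \<times> ?B)"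
    using finite_odd_funs[OF finite_subset[OF \<open>Y \<subseteq> P\<close> fin]] by (simp add: fixed_funs_def)
  ultimately have "card (odd_funs Y) \<le> card (?A \<times> ?B)" by (meson surj_card_le)
  then show ?thesis by (simp add: card_cartesian_product)
qed

section \<open>Joint orbits\<close>

text \<open>
  With \<open>A\<close>, \<open>B\<close> the numbers of \<open>a\<close>-invariant and \<open>b\<close>-invariant odd functions and \<open>O\<close> the number of
  all odd functions, the genus inequality gives \<open>A\<^sup>2 B\<^sup>2 3 ^ #(a \<circ> b) \<le> 9 O\<^sup>2\<close>, while \<open>O \<le> A B\<close>.
\<close>
lemma num_orbits_le_2:
  fixes a b :: "int \<Rightarrow> int"
  assumes "transitive_pair Y a b" and perm: "permutation a" "permutation b"
    and odd: "\<And>x. a (- x) = - a x" "\<And>x. b (- x) = - b x"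
    and sym: "\<And>x. - x \<in> Y \<longleftrightarrow> x \<in> Y" and "0 \<notin> Y"
    and decompose: "card (odd_funs Y) \<le> card (fixed_funs (odd_funs Y) a) * card (fixed_funs (odd_funs Y) b)"
  shows "num_orbits (a \<circ> b) Y \<le> 2"
proof -
  interpret transitive_pair Y a b by fact
  let ?O = "card (odd_funs Y)" and ?V = "supported_funs Y"
  let ?A = "card (fixed_funs (odd_funs Y) a)" and ?B = "card (fixed_funs (odd_funs Y) b)"
  let ?Fa = "card (fixed_funs ?V a)" and ?Fb = "card (fixed_funs ?V b)"
  have "(?A * ?B)\<^sup>2 * 3 ^ num_orbits (a \<circ> b) Y \<le> ?Fa * ?Fb * card (fixed_funs ?V (a \<circ> b))"
    unfolding power_mult_distrib
    by (intro mult_le_mono card_fixed_odd_squared_le power3_num_orbits_le permutation_compose)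
      (simp_all add: finite_Y perm odd a_mem b_mem)
  also have "\<dots> \<le> 9 * card ?V" by (rule genus_inequality)
  also have "\<dots> \<le> 9 * ?O\<^sup>2"
    using card_supported_le_odd_squared[OF finite_Y sym \<open>0 \<notin> Y\<close>] by simp
  also have "\<dots> \<le> 9 * (?A * ?B)\<^sup>2"
    using decompose by (intro mult_le_mono2 power_mono) simp_all
  finally have "(?A * ?B)\<^sup>2 * 3 ^ num_orbits (a \<circ> b) Y \<le> (?A * ?B)\<^sup>2 * 3 ^ 2" by simp
  moreover have "?A * ?B > 0"
  proof -
    have "0 \<in> odd_funs Y" by (simp add: odd_funs_def supported_funs_def)
    then have "?O > 0" using finite_odd_funs[OF finite_Y] card_gt_0_iff by blast
    then show ?thesis using decompose by (rule less_le_trans)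
  qed
  ultimately have "(3::nat) ^ num_orbits (a \<circ> b) Y \<le> 3 ^ 2"
    by (metis mult_le_cancel1 zero_less_power)
  then show ?thesis by (rule power_le_imp_le_exp[rotated]) simp
qed

lemma image_subset_imp_mem_iff:
  assumes "finite S" "inj g" "g ` S \<subseteq> S"
  shows "g x \<in> S \<longleftrightarrow> x \<in> S"
proof -
  have "inj_on g S" using assms(2) by (rule inj_on_subset) simp
  then have "g ` S = S" using assms by (intro endo_inj_surj)
  then show ?thesis using inj_image_mem_iff[OF assms(2), of x S] by simp
qed

lemma generate_preserves_invariant_set:
  assumes G: "\<tau> \<in> carrier (hyperoctahedral_group n)" "\<gamma> \<in> carrier (hyperoctahedral_group n)"
    and S: "finite S" "\<tau> ` S \<subseteq> S" "\<gamma> ` S \<subseteq> S"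
    and g: "g \<in> generate (hyperoctahedral_group n) {\<tau>, \<gamma>}"
  shows "g x \<in> S \<longleftrightarrow> x \<in> S"
  using g
proof (induction arbitrary: x)
  case (incl h)
  then have "h \<in> carrier (hyperoctahedral_group n)" "h ` S \<subseteq> S" using G S by auto
  then show ?case
    using S(1) permutes_inj[OF hyperoctahedral_permutes] by (intro image_subset_imp_mem_iff)
next
  case (inv h)
  then have h: "h \<in> carrier (hyperoctahedral_group n)" "h ` S \<subseteq> S" using G S by auto
  have "h ((inv\<^bsub>hyperoctahedral_group n\<^esub> h) x) = x"
    using group.r_inv[OF group_hyperoctahedral h(1)] by (metis hyperoctahedral_simps comp_apply id_apply)
  then show ?case
    using image_subset_imp_mem_iff[OF S(1) permutes_inj[OF hyperoctahedral_permutes[OF h(1)]] h(2)] by metis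
qed (simp_all add: hyperoctahedral_simps)

text \<open>
  An orbit of the generated group is a minimal nonempty subset that is invariant under the two
  generators; this is the form in which transitivity is used.
\<close>
lemma joint_orbit_properties:
  assumes G: "\<tau> \<in> carrier (hyperoctahedral_group n)" "\<gamma> \<in> carrier (hyperoctahedral_group n)"
    and Y: "Y \<in> joint_orbits n \<tau> \<gamma>"
  shows "Y \<subseteq> signed_points n" "Y \<noteq> {}" "\<tau> ` Y \<subseteq> Y" "\<gamma> ` Y \<subseteq> Y"
    and "\<And>S. S \<subseteq> Y \<Longrightarrow> S \<noteq> {} \<Longrightarrow> \<tau> ` S \<subseteq> S \<Longrightarrow> \<gamma> ` S \<subseteq> S \<Longrightarrow> S = Y"
proof -
  let ?B = "hyperoctahedral_group n" and ?P = "signed_points n"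
  let ?H = "generate ?B {\<tau>, \<gamma>}"
  interpret group ?B by (rule group_hyperoctahedral)
  have "carrier (subgroup_generated ?B {\<tau>, \<gamma>}) = ?H"
    using G by (simp add: carrier_subgroup_generated)
  then obtain x where x: "x \<in> ?P" "Y = {restrict g ?P x | g. g \<in> ?H}"
    using Y by (auto simp: joint_orbits_def Group_Action.orbits_def Group_Action.orbit_def)
  then have Y_eq: "Y = {g x | g. g \<in> ?H}" by simp
  have perm: "\<tau> permutes ?P" "\<gamma> permutes ?P" using G hyperoctahedral_permutes by blast+
  have "g x \<in> ?P" if "g \<in> ?H" for g
    using generate_preserves_invariant_set[OF G finite_signed_points _ _ that] x(1)
      permutes_image[OF perm(1)] permutes_image[OF perm(2)] by simp
  then show sub: "Y \<subseteq> ?P" using Y_eq by auto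
  show "Y \<noteq> {}" using generate.one Y_eq by blast
  have closed: "h ` Y \<subseteq> Y" if "h \<in> {\<tau>, \<gamma>}" for h
  proof
    fix z assume "z \<in> h ` Y"
    then obtain g where "g \<in> ?H" "z = h (g x)" using Y_eq by auto
    moreover from this have "h \<circ> g \<in> ?H"
      using generate.eng[OF generate.incl[OF that]] by (metis hyperoctahedral_simps(1))
    ultimately show "z \<in> Y" unfolding Y_eq by (intro CollectI exI[of _ "h \<circ> g"]) simp
  qed
  then show "\<tau> ` Y \<subseteq> Y" "\<gamma> ` Y \<subseteq> Y" by blast+
  fix S assume S: "S \<subseteq> Y" "S \<noteq> {}" "\<tau> ` S \<subseteq> S" "\<gamma> ` S \<subseteq> S"
  have fin: "finite S" using finite_subset[OF subset_trans[OF S(1) sub] finite_signed_points] .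
  note inv = generate_preserves_invariant_set[OF G fin S(3,4)]
  obtain s where "s \<in> S" using S(2) by blast
  then obtain h where "h \<in> ?H" "s = h x" using S(1) Y_eq by auto
  then have "x \<in> S" using inv \<open>s \<in> S\<close> by blast
  then show "S = Y" using inv S(1) Y_eq by auto
qed

lemma num_orbits_on_joint_orbit_le_2:
  assumes \<gamma>: "\<gamma> \<in> carrier (hyperoctahedral_group n)"
    and ii: "\<And>A. A \<in> perm_orbits \<gamma> (signed_points n) \<Longrightarrow> inversion_invariant A"
    and \<tau>: "\<tau> \<in> type_B_nc n \<gamma>" and Y: "Y \<in> joint_orbits n \<tau> \<gamma>"
  shows "num_orbits \<gamma> Y \<le> 2"
proof -
  let ?B = "hyperoctahedral_group n" and ?P = "signed_points n"
  interpret group ?B by (rule group_hyperoctahedral)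
  define b where "b = inv\<^bsub>?B\<^esub> \<tau> \<otimes>\<^bsub>?B\<^esub> \<gamma>"
  have \<tau>_mem: "\<tau> \<in> carrier ?B" and length: "type_B_length n \<gamma> = type_B_length n \<tau> + type_B_length n b"
    using \<tau> by (auto simp: type_B_nc_def type_B_le_def b_def)
  have b_mem: "b \<in> carrier ?B" using \<tau>_mem \<gamma> by (simp add: b_def)
  have "\<tau> \<otimes>\<^bsub>?B\<^esub> b = \<gamma>" using \<tau>_mem \<gamma> by (simp add: b_def m_assoc[symmetric])
  then have \<gamma>_eq: "\<tau> \<circ> b = \<gamma>" by (simp add: hyperoctahedral_simps)
  have perms: "\<tau> permutes ?P" "b permutes ?P" "\<gamma> permutes ?P"
    using \<tau>_mem b_mem \<gamma> hyperoctahedral_permutes by blast+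
  then have permutations: "permutation \<tau>" "permutation b" "permutation \<gamma>"
    using permutes_imp_permutation[OF finite_signed_points] by blast+
  note joint = joint_orbit_properties[OF \<tau>_mem \<gamma> Y]
  have finY: "finite Y" using finite_subset[OF joint(1) finite_signed_points] .
  have injs: "inj \<tau>" "inj b" "inj \<gamma>" using perms permutes_inj by blast+
  have \<tau>_Y: "\<tau> x \<in> Y \<longleftrightarrow> x \<in> Y" and \<gamma>_Y: "\<gamma> x \<in> Y \<longleftrightarrow> x \<in> Y" for x
    using image_subset_imp_mem_iff[OF finY] injs joint(3,4) by blast+
  have b_Y: "b x \<in> Y \<longleftrightarrow> x \<in> Y" for x
    using \<tau>_Y[of "b x"] \<gamma>_Y[of x] \<gamma>_eq by (metis comp_apply)
  have self: "x \<in> Orbits.orbit \<gamma> x" for x using permutations(3) by (rule permutation_self_in_orbit)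
  have orbit_ii: "inversion_invariant (Orbits.orbit \<gamma> x)" if "x \<in> ?P" for x
    using ii that by (auto simp: perm_orbits_def)
  \<comment> \<open>A joint orbit is a union of orbits of \<open>\<gamma>\<close>, all of which are inversion-invariant.\<close>
  have neg: "- x \<in> Y" if "x \<in> Y" for x
  proof -
    have "- x \<in> Orbits.orbit \<gamma> x"
      using self[of x] orbit_ii[of x] that joint(1) by (auto simp: inversion_invariant_def)
    then show ?thesis using that by induction (simp_all add: \<gamma>_Y)
  qed
  have sym: "- x \<in> Y \<longleftrightarrow> x \<in> Y" for x using neg[of x] neg[of "- x"] by auto
  have transitive: "transitive_pair Y \<tau> b"
  proof
    fix S assume S: "S \<subseteq> Y" "S \<noteq> {}" "\<tau> ` S \<subseteq> S" "b ` S \<subseteq> S"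
    then have "\<gamma> ` S \<subseteq> S" unfolding \<gamma>_eq[symmetric] by fastforce
    with S show "S = Y" using joint(5) by blast
  qed (simp_all add: finY joint(2) \<tau>_Y b_Y injs)
  have "card (odd_funs ?P) * card (odd_funs ?P)
      \<le> (3 ^ type_B_length n \<tau> * card (fixed_funs (odd_funs ?P) \<tau>))
        * (3 ^ type_B_length n b * card (fixed_funs (odd_funs ?P) b))"
    by (intro mult_le_mono card_odd_le_power3_length \<tau>_mem b_mem finite_signed_points)
  also have "\<dots> = 3 ^ type_B_length n \<gamma>
      * (card (fixed_funs (odd_funs ?P) \<tau>) * card (fixed_funs (odd_funs ?P) b))"
    by (simp add: length power_add)
  also have "3 ^ type_B_length n \<gamma> \<le> (3::nat) ^ n"
    using type_B_length_attained(1)[OF \<gamma>] by (intro power_increasing) simp_all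
  also have "3 ^ n \<le> card (odd_funs ?P)" by (rule power3_le_card_odd_signed_points)
  finally have "card (odd_funs ?P) * card (odd_funs ?P) \<le> card (odd_funs ?P)
      * (card (fixed_funs (odd_funs ?P) \<tau>) * card (fixed_funs (odd_funs ?P) b))"
    by simp
  moreover have "card (odd_funs ?P) > 0"
    by (rule less_le_trans[OF _ power3_le_card_odd_signed_points]) simp
  ultimately have large: "card (odd_funs ?P)
      \<le> card (fixed_funs (odd_funs ?P) \<tau>) * card (fixed_funs (odd_funs ?P) b)"
    by simp
  have trivial: "f = 0" if f: "f \<in> odd_funs ?P" "f \<circ> (\<tau> \<circ> b) = f" for f
  proof
    fix x
    show "f x = 0 x"
    proof (cases "x \<in> ?P")
      case True
      then show ?thesis
        using f inversion_invariant_orbit_kills_odd[of f \<gamma> x, OF _ _ self orbit_ii]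
        by (simp add: odd_funs_def \<gamma>_eq)
    qed (use f in \<open>simp add: odd_funs_def supported_funs_def\<close>)
  qed
  have "card (odd_funs Y) \<le> card (fixed_funs (odd_funs Y) \<tau>) * card (fixed_funs (odd_funs Y) b)"
    using odd_funs_decompose[OF finite_signed_points large trivial]
    by (rule card_odd_le_on_invariant_subset[OF finite_signed_points _ joint(1) sym \<tau>_Y b_Y])
  moreover have "0 \<notin> Y" using joint(1) by (auto simp: signed_points_def)
  ultimately have "num_orbits (\<tau> \<circ> b) Y \<le> 2"
    using transitive permutations(1,2) hyperoctahedral_odd[OF \<tau>_mem] hyperoctahedral_odd[OF b_mem] sym
    by (intro num_orbits_le_2)
  then show ?thesis by (simp add: \<gamma>_eq)
qed

theorem proposition6p4:
  fixes n k m :: nat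
    and ns :: "nat \<Rightarrow> nat"
    and \<gamma> \<tau> :: "int \<Rightarrow> int"
    and C Y :: "nat \<Rightarrow> int set"
  assumes "k \<ge> 1"
    and "\<And>i. i \<in> {1..k} \<Longrightarrow> ns i \<ge> 1"
    and "(\<Sum>i=1..k. ns i) = n"
    and "\<gamma> \<in> carrier (hyperoctahedral_group n)"
    and "bij_betw C {1..k} (perm_orbits \<gamma> (signed_points n))"
    and "\<And>i. i \<in> {1..k} \<Longrightarrow> inversion_invariant (C i)"
    and "\<And>i. i \<in> {1..k} \<Longrightarrow> card (C i) = 2 * ns i"
    and "\<tau> \<in> type_B_nc n \<gamma>"
    and "card (joint_orbits n \<tau> \<gamma>) = m"
    and "bij_betw Y {1..m} (joint_orbits n \<tau> \<gamma>)"
  shows "\<forall>j\<in>{1..m}.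
           num_orbits (perm_restrict \<gamma> (Y j)) (Y j) = num_ii_orbits (perm_restrict \<gamma> (Y j)) (Y j) \<and>
           num_ii_orbits (perm_restrict \<gamma> (Y j)) (Y j) \<le> 2"
proof
  fix j assume "j \<in> {1..m}"
  then have Y: "Y j \<in> joint_orbits n \<tau> \<gamma>" using assms(10) bij_betwE by blast
  have "\<tau> \<in> carrier (hyperoctahedral_group n)" using assms(8) by (simp add: type_B_nc_def)
  note joint = joint_orbit_properties[OF this assms(4) Y]
  have ii: "inversion_invariant A" if "A \<in> perm_orbits \<gamma> (signed_points n)" for A
  proof -
    have "A \<in> C ` {1..k}" using that bij_betw_imp_surj_on[OF assms(5)] by simp
    then show ?thesis using assms(6) by (elim imageE) simp
  qed
  have "Orbits.orbit (perm_restrict \<gamma> (Y j)) x = Orbits.orbit \<gamma> x" if "x \<in> Y j" for x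
    by (rule orbit_cong0[OF that, symmetric]) (use joint(4) in \<open>auto simp: perm_restrict_def\<close>)
  then have restrict: "perm_orbits (perm_restrict \<gamma> (Y j)) (Y j) = perm_orbits \<gamma> (Y j)"
    by (simp add: perm_orbits_def)
  have "{A \<in> perm_orbits \<gamma> (Y j). inversion_invariant A} = perm_orbits \<gamma> (Y j)"
    using ii joint(1) by (auto simp: perm_orbits_def)
  then have "num_orbits (perm_restrict \<gamma> (Y j)) (Y j) = num_orbits \<gamma> (Y j)"
    "num_ii_orbits (perm_restrict \<gamma> (Y j)) (Y j) = num_orbits \<gamma> (Y j)"
    by (simp_all add: num_orbits_def num_ii_orbits_def restrict)
  moreover have "num_orbits \<gamma> (Y j) \<le> 2"
    using num_orbits_on_joint_orbit_le_2[OF assms(4) ii assms(8) Y] .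
  ultimately show "num_orbits (perm_restrict \<gamma> (Y j)) (Y j) = num_ii_orbits (perm_restrict \<gamma> (Y j)) (Y j) \<and>
      num_ii_orbits (perm_restrict \<gamma> (Y j)) (Y j) \<le> 2"
    by simp
qed

end
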